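(* Let $X$ be a finite set with $|X|=n$, $n\geq 3$, let $\tau$ be the discrete topology on $X$, and let $G_\tau$ be the discrete topological graph of $X$. Then the radius and the diameter of $G_\tau$ satisfy $\mathrm{rad}(G_\tau)=2$ and $\mathrm{diam}(G_\tau)=3$.
   Context: For a non-empty set $X$ with the discrete topology $\tau$ (so $\tau$ is the family of all subsets of $X$), the discrete topological graph $G_\tau=(V,E)$ is the simple undirected graph with vertex set $V=\{A\in\tau : A\neq\emptyset,\ A\neq X\}$ in which two vertices $A,B$ are adjacent if and only if $A\cap B=\emptyset$. The eccentricity of a vertex is its maximum distance to any other vertex; the radius is the minimum eccentricity and the diameter the maximum eccentricity over all vertices. *)

theory Defs
  imports
    "Graph_Theory.Graph_Theory"
    "HOL-Analysis.Abstract_Topology"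
begin

text \<open>
  As usual in Graph_Theory, an undirected edge is a pair of opposite arcs. No side condition
  \<open>A \<noteq> B\<close> is needed: a non-empty set is not disjoint from itself.
\<close>
definition discrete_topological_graph :: "'a set \<Rightarrow> 'a set pair_pre_digraph" where
  "discrete_topological_graph X =
    (let V = {A. openin (discrete_topology X) A \<and> A \<noteq> {} \<and> A \<noteq> X}
     in \<lparr> pverts = V, parcs = {(A, B). A \<in> V \<and> B \<in> V \<and> A \<inter> B = {}} \<rparr>)"

lemma pair_graph_discrete_topological_graph:
  assumes "finite X"
  shows "pair_graph (discrete_topological_graph X)"
proof -
  let ?G = "discrete_topological_graph X"
  have V: "pverts ?G \<subseteq> Pow X"
    by (auto simp: discrete_topological_graph_def Let_def)
  have fV: "finite (pverts ?G)"
    using V assms by (meson finite_Pow_iff finite_subset)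
  have A: "parcs ?G \<subseteq> pverts ?G \<times> pverts ?G"
    by (auto simp: discrete_topological_graph_def Let_def)
  have fA: "finite (parcs ?G)"
    using A fV by (meson finite_SigmaI finite_subset)
  have s: "symmetric (with_proj ?G)"
    by (auto simp: symmetric_def sym_def discrete_topological_graph_def Let_def)
  show ?thesis
    using A fV fA s
    by unfold_locales (auto simp: discrete_topological_graph_def Let_def)
qed

text \<open>
  With unit arc costs, \<open>\<mu>\<close> is the least number of arcs of a walk from \<open>u\<close> to \<open>v\<close>,
  and \<open>\<infinity>\<close> if there is none.
\<close>
definition graph_dist :: "('a, 'b) pre_digraph \<Rightarrow> 'a \<Rightarrow> 'a \<Rightarrow> ereal" where
  "graph_dist G u v = wf_digraph.\<mu> G (\<lambda>_. 1) u v"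

text \<open>On a finite graph with at least two vertices, all suprema and infima below are attained.\<close>
definition eccentricity :: "('a, 'b) pre_digraph \<Rightarrow> 'a \<Rightarrow> ereal" where
  "eccentricity G u = (SUP v\<in>verts G - {u}. graph_dist G u v)"

definition graph_radius :: "('a, 'b) pre_digraph \<Rightarrow> ereal" where
  "graph_radius G = (INF u\<in>verts G. eccentricity G u)"

definition graph_diameter :: "('a, 'b) pre_digraph \<Rightarrow> ereal" where
  "graph_diameter G = (SUP u\<in>verts G. eccentricity G u)"

end

theory Submission
  imports Defs
begin

text \<open>
  Everything rests on a dictionary between short walks and the Boolean algebra of \<open>X\<close>. Two
  distinct vertices \<open>A\<close>, \<open>B\<close> are at distance 1 when \<open>A \<inter> B = {}\<close>; if they meet, a common neighbour
  is a non-empty set avoiding \<open>A \<union> B\<close>, so they are at distance 2 exactly when \<open>A \<union> B \<noteq> X\<close>.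
  In every case two points \<open>a \<notin> A\<close> and \<open>b \<notin> B\<close> give a walk from \<open>A\<close> to \<open>B\<close> through \<open>{a}\<close> and
  \<open>{b}\<close> (through a single set if \<open>a = b\<close>), so no distance exceeds 3.

  The diameter is attained by the complements of two distinct points: they cover \<open>X\<close>, and they
  meet in any third point. For the radius, a set \<open>B\<close> that meets a singleton \<open>{x}\<close>
  contains \<open>x\<close>, and then \<open>{x}\<close> is disjoint from \<open>{b}\<close> for each \<open>b \<notin> B\<close>; hence singletons have
  eccentricity at most 2. Nothing has smaller eccentricity, because with at least three points
  every vertex meets some other vertex.
\<close>

section \<open>Unit-cost distance and walk length\<close>

context wf_digraph
begin

lemma unit_awalk_cost: "awalk_cost (\<lambda>_. 1) p = real (length p)"
  by (induct p) auto

lemma graph_dist_le_length: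
  assumes "awalk u p v"
  shows "graph_dist G u v \<le> ereal (real (length p))"
  using min_cost_le_walk_cost[OF assms, of "\<lambda>_. 1"]
  by (simp add: graph_dist_def unit_awalk_cost)

lemma le_graph_distI:
  assumes "\<And>p. awalk u p v \<Longrightarrow> k \<le> length p"
  shows "ereal (real k) \<le> graph_dist G u v"
  using assms by (auto simp: graph_dist_def \<mu>_def unit_awalk_cost intro!: INF_greatest)

end

section \<open>Distances between subsets\<close>

lemma pverts_discrete_topological_graph:
  "pverts (discrete_topological_graph X) = {A. A \<subseteq> X \<and> A \<noteq> {} \<and> A \<noteq> X}"
  by (simp add: discrete_topological_graph_def)

lemma parcs_discrete_topological_graph:
  "parcs (discrete_topological_graph X) =
    {(A, B). A \<in> pverts (discrete_topological_graph X) \<and>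
             B \<in> pverts (discrete_topological_graph X) \<and> A \<inter> B = {}}"
  by (simp add: discrete_topological_graph_def Let_def)

locale finite_discrete_topological_graph =
  fixes X :: "'a set"
  assumes finite_X: "finite X"
begin

abbreviation G where "G \<equiv> discrete_topological_graph X"

sublocale pair_graph G
  by (rule pair_graph_discrete_topological_graph[OF finite_X])

lemma dist_le_1:
  assumes "A \<in> pverts G" "B \<in> pverts G" "A \<inter> B = {}"
  shows "graph_dist G A B \<le> 1"
proof -
  have "awalk A [(A, B)] B"
    using assms by (simp add: awalk_simps parcs_discrete_topological_graph)
  from graph_dist_le_length[OF this] show ?thesis by (simp add: one_ereal_def)
qed

lemma dist_le_2:
  assumes "A \<in> pverts G" "B \<in> pverts G" "C \<in> pverts G" "A \<inter> C = {}" "C \<inter> B = {}"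
  shows "graph_dist G A B \<le> 2"
proof -
  have "awalk A [(A, C), (C, B)] B"
    using assms by (simp add: awalk_simps parcs_discrete_topological_graph)
  from graph_dist_le_length[OF this] show ?thesis by simp
qed

lemma dist_le_3:
  assumes A: "A \<in> pverts G" and B: "B \<in> pverts G"
  shows "graph_dist G A B \<le> 3"
proof -
  obtain a b where a: "a \<in> X" "a \<notin> A" and b: "b \<in> X" "b \<notin> B"
    using A B by (auto simp: pverts_discrete_topological_graph)
  have ab: "{a} \<in> pverts G" "{b} \<in> pverts G"
    using A B a b by (auto simp: pverts_discrete_topological_graph)
  show ?thesis
  proof (cases "a = b")
    case True
    then have "graph_dist G A B \<le> 2"
      using dist_le_2[OF A B ab(1)] a b by auto
    also have "(2 :: ereal) \<le> 3" by simp
    finally show ?thesis .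
  next
    case False
    then have "awalk A [(A, {a}), ({a}, {b}), ({b}, B)] B"
      using A B a b ab by (simp add: awalk_simps parcs_discrete_topological_graph)
    from graph_dist_le_length[OF this] show ?thesis by simp
  qed
qed

lemma dist_ge_2:
  assumes "A \<noteq> B" "A \<inter> B \<noteq> {}"
  shows "2 \<le> graph_dist G A B"
proof -
  have "2 \<le> length p" if "awalk A p B" for p
  proof (rule ccontr)
    assume "\<not> 2 \<le> length p"
    then consider "p = []" | e where "p = [e]"
      by (cases p; cases "tl p") auto
    then show False
      using that assms by cases (auto simp: awalk_simps parcs_discrete_topological_graph)
  qed
  from le_graph_distI[OF this] show ?thesis by simp
qed

text \<open>
  A walk of length 2 would pass through a vertex disjoint from both ends, which cannot exist when
  the ends cover \<open>X\<close>.
\<close>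
lemma dist_ge_3:
  assumes "A \<noteq> B" "A \<inter> B \<noteq> {}" "A \<union> B = X"
  shows "3 \<le> graph_dist G A B"
proof -
  have "3 \<le> length p" if "awalk A p B" for p
  proof (rule ccontr)
    assume "\<not> 3 \<le> length p"
    then consider "p = []" | e where "p = [e]" | e f where "p = [e, f]"
      by (cases p; cases "tl p"; cases "tl (tl p)") auto
    then show False
    proof cases
      case (3 e f)
      then have "snd e \<in> pverts G" "A \<inter> snd e = {}" "snd e \<inter> B = {}"
        using that by (auto simp: awalk_simps parcs_discrete_topological_graph)
      then show False
        using assms(3) by (auto simp: pverts_discrete_topological_graph)
    qed (use that assms in \<open>auto simp: awalk_simps parcs_discrete_topological_graph\<close>)
  qed
  from le_graph_distI[OF this] show ?thesis by simp
qed

section \<open>Eccentricities\<close>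

lemma eccentricity_le_3:
  assumes "A \<in> pverts G"
  shows "eccentricity G A \<le> 3"
  unfolding eccentricity_def using assms dist_le_3 by (auto intro!: SUP_least)

lemma eccentricity_singleton_le_2:
  assumes x: "{x} \<in> pverts G"
  shows "eccentricity G {x} \<le> 2"
  unfolding eccentricity_def
proof (rule SUP_least)
  fix B assume "B \<in> verts G - {{x}}"
  then have B: "B \<in> pverts G" by simp
  show "graph_dist G {x} B \<le> 2"
  proof (cases "x \<in> B")
    case True
    obtain b where b: "b \<in> X" "b \<notin> B"
      using B by (auto simp: pverts_discrete_topological_graph)
    then have "{b} \<in> pverts G"
      using B by (auto simp: pverts_discrete_topological_graph)
    from dist_le_2[OF x B this] True b show ?thesis by auto
  next
    case False
    then have "graph_dist G {x} B \<le> 1"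
      using dist_le_1[OF x B] by simp
    also have "(1 :: ereal) \<le> 2" by simp
    finally show ?thesis .
  qed
qed

lemma dist_le_eccentricity:
  assumes "B \<in> pverts G" "A \<noteq> B"
  shows "graph_dist G A B \<le> eccentricity G A"
  unfolding eccentricity_def using assms by (auto intro: SUP_upper)

lemma eccentricity_ge_2:
  assumes card: "3 \<le> card X" and A: "A \<in> pverts G"
  shows "2 \<le> eccentricity G A"
proof -
  obtain x y where x: "x \<in> A" and y: "y \<in> X" "y \<notin> A"
    using A by (auto simp: pverts_discrete_topological_graph)
  have "card {x, y} < card X" "card {x} < card X"
    using card by (auto simp: card_insert_if)
  then have xy: "{x, y} \<in> pverts G" "{x} \<in> pverts G"
    using A x y by (auto simp: pverts_discrete_topological_graph)
  \<comment> \<open>The singleton \<open>{x}\<close> witnesses the bound unless it is \<open>A\<close> itself; then the pair \<open>{x, y}\<close> does.\<close>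
  obtain B where B: "B \<in> pverts G" "A \<noteq> B" "A \<inter> B \<noteq> {}"
  proof (cases "A = {x}")
    case True
    then show ?thesis using that[of "{x, y}"] xy y by auto
  next
    case False
    then show ?thesis using that[of "{x}"] xy x by auto
  qed
  show ?thesis
    using dist_ge_2[OF B(2,3)] dist_le_eccentricity[OF B(1,2)] by (rule order_trans)
qed

theorem radius_eq_2:
  assumes card: "3 \<le> card X"
  shows "graph_radius G = 2"
proof (rule antisym)
  obtain x where x: "x \<in> X" using card by fastforce
  have "X \<noteq> {x}" using card by auto
  with x have v: "{x} \<in> pverts G"
    by (auto simp: pverts_discrete_topological_graph)
  then have "graph_radius G \<le> eccentricity G {x}"
    unfolding graph_radius_def by (auto intro: INF_lower)
  also have "\<dots> \<le> 2" by (rule eccentricity_singleton_le_2[OF v])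
  finally show "graph_radius G \<le> 2" .
  show "2 \<le> graph_radius G"
    unfolding graph_radius_def using eccentricity_ge_2[OF card] by (auto intro!: INF_greatest)
qed

theorem diameter_eq_3:
  assumes card: "3 \<le> card X"
  shows "graph_diameter G = 3"
proof (rule antisym)
  show "graph_diameter G \<le> 3"
    unfolding graph_diameter_def using eccentricity_le_3 by (auto intro!: SUP_least)
  obtain T where T: "T \<subseteq> X" "card T = 3"
    using obtain_subset_with_card_n[OF card] by blast
  then obtain x y z where xyz: "T = {x, y, z}" "x \<noteq> y" "x \<noteq> z" "y \<noteq> z"
    by (auto simp: card_3_iff)
  let ?A = "X - {x}" and ?B = "X - {y}"
  have v: "?A \<in> pverts G" "?B \<in> pverts G"
    using T xyz by (auto simp: pverts_discrete_topological_graph)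
  have neq: "?A \<noteq> ?B" and meet: "?A \<inter> ?B \<noteq> {}" and cover: "?A \<union> ?B = X"
    using T xyz by auto
  have "3 \<le> graph_dist G ?A ?B"
    by (rule dist_ge_3[OF neq meet cover])
  also have "\<dots> \<le> eccentricity G ?A"
    by (rule dist_le_eccentricity[OF v(2) neq])
  also have "\<dots> \<le> graph_diameter G"
    unfolding graph_diameter_def using v(1) by (auto intro: SUP_upper)
  finally show "3 \<le> graph_diameter G" .
qed

end

theorem theorem2p13:
  fixes X :: "'a set" and n :: nat
  assumes "finite X" and "card X = n" and "n \<ge> 3"
  shows "graph_radius (with_proj (discrete_topological_graph X)) = 2 \<and>
         graph_diameter (with_proj (discrete_topological_graph X)) = 3"
proof -
  interpret finite_discrete_topological_graph X
    by unfold_locales (rule assms(1))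
  from assms have "3 \<le> card X" by simp
  then show ?thesis using radius_eq_2 diameter_eq_3 by blast
qed

end
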